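(* Let $\mathbb{F}\in\{\mathbb{R},\mathbb{C}\}$, fix $\tau>0$, and let $\omega\in\mathbb{F}^d$ be an isotropic random vector with $\mathbb{P}\{|\langle\omega,u\rangle|^2\le\tau\}\le 1/100$ for every unit vector $u\in\mathbb{F}^d$. Let $\Omega = k^{-1/2}[\omega_1,\dots,\omega_k]\in\mathbb{F}^{d\times k}$ with $\omega_i$ iid copies of $\omega$. Then $\Omega$ is an $(r,\tau/10)$-OSI whenever $k\ge\max\{3r,131\}$ (if $\mathbb{F}=\mathbb{R}$) or $k\ge\max\{18r,169\}$ (if $\mathbb{F}=\mathbb{C}$).
   Context: Isotropic means $\mathbb{E}[\omega\omega^*]=I$; $\langle x,y\rangle=x^*y$, $^*$ conjugate transpose. A random matrix $\Omega\in\mathbb{F}^{d\times k}$ is an $(r,\alpha)$-OSI ($k\ge r$, $\alpha\in(0,1]$) if (1) $\mathbb{E}\|\Omega^*x\|_2^2=\|x\|_2^2$ for all $x\in\mathbb{F}^d$; and (2) for each fixed $r$-dimensional subspace $V\subseteq\mathbb{F}^d$, with probability at least $19/20$, $\alpha\|x\|_2^2\le\|\Omega^*x\|_2^2$ for all $x\in V$. *)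

theory Defs
  imports "HOL-Probability.Probability" "Jordan_Normal_Form.Conjugate"
begin

text \<open>
  The scalar field is a type \<open>'a\<close> to be instantiated with \<^typ>\<open>real\<close> or \<^typ>\<open>complex\<close>.
  The sort constraints below give conjugation and the absolute value of \<open>'a\<close>; on
  \<open>'a ^ 'd\<close>, \<^const>\<open>norm\<close> is the Euclidean norm and the Borel sets are the usual ones.
\<close>

definition adjoint_matrix :: "'a::conjugate ^ 'k ^ 'd \<Rightarrow> 'a ^ 'd ^ 'k" where
  "adjoint_matrix A = (\<chi> j i. conjugate (A $ i $ j))"

text \<open>Conjugate-linear in the first argument.\<close>

definition cinner :: "'a::{semiring_1, conjugate} ^ 'd \<Rightarrow> 'a ^ 'd \<Rightarrow> 'a" where
  "cinner x y = (\<Sum>i\<in>UNIV. conjugate (x $ i) * y $ i)"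

definition outer_self :: "'a::{semiring_1, conjugate} ^ 'd \<Rightarrow> 'a ^ 'd ^ 'd" where
  "outer_self x = (\<chi> i j. x $ i * conjugate (x $ j))"

text \<open>The use of \<^const>\<open>has_bochner_integral\<close> makes finiteness of the second moments explicit.\<close>

definition isotropic ::
  "'s measure \<Rightarrow> ('s \<Rightarrow> 'a::{euclidean_space, real_normed_field, conjugatable_field} ^ 'd) \<Rightarrow> bool"
where
  "isotropic M \<omega> \<longleftrightarrow>
     \<omega> \<in> borel_measurable M \<and>
     has_bochner_integral M (\<lambda>s. outer_self (\<omega> s)) (mat 1)"

text \<open>The copies may live on a probability space \<open>N\<close> different from that of \<open>\<omega>\<close>.\<close>

definition iid_copies ::
  "'s measure \<Rightarrow> ('s \<Rightarrow> 'b::topological_space) \<Rightarrow> 't measure \<Rightarrow> ('k \<Rightarrow> 't \<Rightarrow> 'b) \<Rightarrow> bool"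
where
  "iid_copies M \<omega> N X \<longleftrightarrow>
     prob_space.indep_vars N (\<lambda>_. borel) X UNIV \<and>
     (\<forall>j. distr N borel (X j) = distr M borel \<omega>)"

text \<open>The matrix whose \<open>j\<close>-th column is \<open>X j\<close> divided by the square root of the number of columns.\<close>

definition scaled_columns ::
  "('k::finite \<Rightarrow> 'a::{euclidean_space, real_normed_field} ^ 'd) \<Rightarrow> 'a ^ 'k ^ 'd"
where
  "scaled_columns X = (1 / sqrt (real CARD('k))) *\<^sub>R (\<chi> i j. X j $ i)"

text \<open>
  Subspaces and their dimensions are taken over the scalar field \<open>'a\<close>: for complex scalars
  \<^const>\<open>vec.subspace\<close> and \<^const>\<open>vec.dim\<close> are complex, not real, notions. The event in the last
  clause is measurable, being the preimage of a closed set of matrices.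
\<close>

definition osi ::
  "'t measure \<Rightarrow> ('t \<Rightarrow> 'a::{euclidean_space, real_normed_field, conjugatable_field} ^ 'k ^ 'd)
     \<Rightarrow> nat \<Rightarrow> real \<Rightarrow> bool"
where
  "osi N \<Omega> r \<alpha> \<longleftrightarrow>
     r \<le> CARD('k) \<and> 0 < \<alpha> \<and> \<alpha> \<le> 1 \<and>
     \<Omega> \<in> borel_measurable N \<and>
     (\<forall>x. has_bochner_integral N
            (\<lambda>t. (norm (adjoint_matrix (\<Omega> t) *v x))\<^sup>2) ((norm x)\<^sup>2)) \<and>
     (\<forall>V :: ('a ^ 'd) set. vec.subspace V \<and> vec.dim V = r \<longrightarrow>
        measure N {t \<in> space N. \<forall>x\<in>V.
            \<alpha> * (norm x)\<^sup>2 \<le> (norm (adjoint_matrix (\<Omega> t) *v x))\<^sup>2} \<ge> 19 / 20)"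

end

theory Submission
  imports Defs
begin

text \<open>
  Suppose a unit vector \<open>x\<close> of the subspace \<open>V\<close> violates the lower bound and let \<open>m\<close> be the real
  dimension of the scalar field (1 or 2). Then all but fewer than \<open>m k / 10\<close> of the samples satisfy
  \<open>\<bar>\<langle>\<omega>\<^sub>j, x\<rangle>\<bar>\<^sup>2 \<le> \<tau> / m\<close>. The real coordinates of these scalar products, together with a box that
  keeps things bounded, cut out a polytope in \<open>V\<close> containing \<open>x\<close>. A point \<open>v\<close> of largest norm
  in it is a vertex, hence determined by at most \<open>D = m r\<close> tight constraints and their signs, while
  the other samples in question satisfy \<open>\<bar>\<langle>\<omega>\<^sub>j, v\<rangle>\<bar>\<^sup>2 \<le> \<tau> \<le> \<tau> \<parallel>v\<parallel>\<^sup>2\<close>. These other samples are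
  independent of \<open>v\<close>, so each of the at most \<open>3\<^sup>m\<^sup>k\<^sup>+\<^sup>D 2\<^sup>k\<close> patterns of signs and exceptional indices has
  probability at most \<open>100\<^sup>-\<^sup>n\<close>, where \<open>n \<ge> (1 - m / 10) k - D\<close>, and a union bound suffices.
\<close>

section \<open>Vertices of symmetric polytopes\<close>

text \<open>On \<open>V\<close> each \<open>a i\<close> acts as the inner product with its
  orthogonal projection \<open>p i\<close> to \<open>V\<close>. A maximal independent subset of
  these projections has at most \<open>dim V\<close> members and spans them all, so a vector of
  \<open>V\<close> orthogonal to it is annihilated by every functional.\<close>

lemma spanning_functionals_subset:
  fixes a :: "'i \<Rightarrow> 'e::euclidean_space"
  assumes V: "subspace V"
    and sep: "\<forall>y\<in>V. (\<forall>i\<in>J. a i \<bullet> y = 0) \<longrightarrow> y = 0"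
  obtains S where "S \<subseteq> J" "finite S" "card S \<le> dim V"
    "\<forall>y\<in>V. (\<forall>i\<in>S. a i \<bullet> y = 0) \<longrightarrow> y = 0"
proof -
  have "\<exists>p. p \<in> V \<and> (\<forall>y\<in>V. a i \<bullet> y = p \<bullet> y)" for i
  proof -
    obtain p q where pq: "p \<in> span V" "\<And>w. w \<in> span V \<Longrightarrow> orthogonal q w" "a i = p + q"
      using orthogonal_subspace_decomp_exists by metis
    have "a i \<bullet> y = p \<bullet> y" if "y \<in> V" for y
      using pq(2)[OF span_base[OF that]] pq(3) by (simp add: inner_add_left orthogonal_def)
    then show ?thesis using pq(1) V by (metis span_eq_iff)
  qed
  then obtain p where p: "\<And>i. p i \<in> V" "\<And>i y. y \<in> V \<Longrightarrow> a i \<bullet> y = p i \<bullet> y"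
    by metis
  obtain B where B: "B \<subseteq> p ` J" "independent B" "p ` J \<subseteq> span B"
    using maximal_independent_subset by blast
  obtain S where S: "S \<subseteq> J" "inj_on p S" "B = p ` S"
    using B(1) by (metis subset_image_inj)
  have "finite B" using B(2) by (rule independent_imp_finite)
  then have fin: "finite S" using S finite_image_iff by blast
  have "B \<subseteq> V" using B(1) p(1) by blast
  then have "card B \<le> dim V" using B(2) by (rule independent_card_le_dim)
  then have card: "card S \<le> dim V" using S by (simp add: card_image)
  have "y = 0" if y: "y \<in> V" "\<forall>i\<in>S. a i \<bullet> y = 0" for y
  proof (rule sep[rule_format, OF y(1)])
    fix i assume "i \<in> J"
    then have "p i \<in> span B" using B(3) by blast
    moreover have "orthogonal y z" if "z \<in> B" for z
      using that y p(2) S(3) by (auto simp: orthogonal_def inner_commute)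
    ultimately have "orthogonal y (p i)" by (rule orthogonal_to_span)
    then show "a i \<bullet> y = 0" using p(2) y(1) by (simp add: orthogonal_def inner_commute)
  qed
  then show ?thesis using that S(1) fin card by blast
qed

text \<open>The point of largest norm in a symmetric polytope is a vertex: along a direction on which all
  tight constraints vanish one could move and increase the norm.\<close>

lemma polytope_vertex:
  fixes a :: "'i \<Rightarrow> 'e::euclidean_space"
  assumes V: "subspace V" and I: "finite I"
    and bdd: "bounded {y\<in>V. \<forall>i\<in>I. \<bar>a i \<bullet> y\<bar> \<le> c i}"
    and x: "x \<in> V" "\<forall>i\<in>I. \<bar>a i \<bullet> x\<bar> \<le> c i"
  obtains v S where "v \<in> V" "\<forall>i\<in>I. \<bar>a i \<bullet> v\<bar> \<le> c i" "norm x \<le> norm v"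
    "S \<subseteq> I" "card S \<le> dim V" "\<forall>i\<in>S. \<bar>a i \<bullet> v\<bar> = c i"
    "\<forall>y\<in>V. (\<forall>i\<in>S. a i \<bullet> y = 0) \<longrightarrow> y = 0"
proof -
  let ?P = "{y\<in>V. \<forall>i\<in>I. \<bar>a i \<bullet> y\<bar> \<le> c i}"
  have "?P = V \<inter> (\<Inter>i\<in>I. {y. \<bar>a i \<bullet> y\<bar> \<le> c i})" by auto
  moreover have "closed (V \<inter> (\<Inter>i\<in>I. {y. \<bar>a i \<bullet> y\<bar> \<le> c i}))"
    by (intro closed_Int closed_subspace V closed_INT ballI closed_Collect_le continuous_intros)
  ultimately have "compact ?P" using bdd by (simp add: compact_eq_bounded_closed)
  moreover have "?P \<noteq> {}" using x by auto
  ultimately obtain v where v: "v \<in> ?P" and vmax: "\<And>y. y \<in> ?P \<Longrightarrow> norm y \<le> norm v"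
    using continuous_attains_sup[of ?P norm] continuous_on_norm_id by blast
  let ?J = "{i\<in>I. \<bar>a i \<bullet> v\<bar> = c i}"
  have sep: "z = 0" if z: "z \<in> V" "\<forall>i\<in>?J. a i \<bullet> z = 0" for z
  proof (rule ccontr)
    assume "z \<noteq> 0"
    \<comment> \<open>Of the two directions \<open>z\<close> and \<open>- z\<close>, this one does
      not decrease the norm to first order; the quadratic term then makes the increase
      strict.\<close>
    define y where "y = (if z \<bullet> v \<ge> 0 then z else - z)"
    have y: "y \<in> V" "\<forall>i\<in>?J. a i \<bullet> y = 0" "y \<noteq> 0" "v \<bullet> y \<ge> 0"
      using z \<open>z \<noteq> 0\<close> V by (auto simp: y_def subspace_neg inner_commute)
    have steps: "\<exists>e. e > 0 \<and> (\<forall>d\<in>{0..e}. \<bar>a i \<bullet> (v + d *\<^sub>R y)\<bar> \<le> c i)"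
      if i: "i \<in> I" for i
    proof (cases "i \<in> ?J")
      case True
      then show ?thesis using y(2) by (intro exI[of _ 1]) (auto simp: inner_add_right)
    next
      case False
      then have lt: "\<bar>a i \<bullet> v\<bar> < c i" using v i by (auto simp: less_le)
      \<comment> \<open>A slack constraint leaves room for a positive step; the \<open>+ 1\<close>
        avoids a zero denominator.\<close>
      define e where "e = (c i - \<bar>a i \<bullet> v\<bar>) / (\<bar>a i \<bullet> y\<bar> + 1)"
      have e: "e > 0" using lt by (auto simp: e_def)
      have "\<bar>a i \<bullet> (v + d *\<^sub>R y)\<bar> \<le> c i" if d: "d \<in> {0..e}" for d
      proof -
        have "\<bar>a i \<bullet> (v + d *\<^sub>R y)\<bar> \<le> \<bar>a i \<bullet> v\<bar> + d * \<bar>a i \<bullet> y\<bar>"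
          using d by (auto simp: inner_add_right abs_mult intro!: order_trans[OF abs_triangle_ineq])
        also have "d * \<bar>a i \<bullet> y\<bar> \<le> e * (\<bar>a i \<bullet> y\<bar> + 1)"
          using d by (intro mult_mono) auto
        also have "\<dots> = c i - \<bar>a i \<bullet> v\<bar>"
          unfolding e_def by (simp add: divide_simps)
        finally show ?thesis by simp
      qed
      then show ?thesis using e by (intro exI[of _ e]) auto
    qed
    have "\<exists>e. \<forall>i\<in>I. e i > 0 \<and> (\<forall>d\<in>{0..e i}. \<bar>a i \<bullet> (v + d *\<^sub>R y)\<bar> \<le> c i)"
      by (intro bchoice ballI steps)
    then obtain e where e: "\<And>i. i \<in> I \<Longrightarrow> e i > 0"
      "\<And>i d. i \<in> I \<Longrightarrow> d \<in> {0..e i} \<Longrightarrow> \<bar>a i \<bullet> (v + d *\<^sub>R y)\<bar> \<le> c i" by blast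
    \<comment> \<open>The extra 1 keeps the minimum meaningful when \<open>I\<close> is
      empty.\<close>
    define d where "d = Min (insert 1 (e ` I))"
    have d: "d > 0" "\<And>i. i \<in> I \<Longrightarrow> d \<le> e i"
      using I e(1) by (auto simp: d_def)
    have "v + d *\<^sub>R y \<in> ?P"
      using v y(1) V d e(2) by (auto simp: subspace_add subspace_scale)
    then have "norm (v + d *\<^sub>R y) \<le> norm v" by (rule vmax)
    then have "(norm (v + d *\<^sub>R y))\<^sup>2 \<le> (norm v)\<^sup>2" by simp
    moreover have "(norm (v + d *\<^sub>R y))\<^sup>2 = (norm v)\<^sup>2 + 2 * d * (v \<bullet> y) + d\<^sup>2 * (norm y)\<^sup>2"
      by (simp only: power2_norm_eq_inner)
        (simp add: algebra_simps inner_commute power2_eq_square)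
    moreover have "2 * d * (v \<bullet> y) \<ge> 0" "d\<^sup>2 * (norm y)\<^sup>2 > 0" using d y by auto
    ultimately show False by linarith
  qed
  obtain S where S: "S \<subseteq> ?J" "finite S" "card S \<le> dim V"
    "\<forall>y\<in>V. (\<forall>i\<in>S. a i \<bullet> y = 0) \<longrightarrow> y = 0"
    using spanning_functionals_subset[OF V, of ?J a] sep by blast
  show ?thesis
    by (rule that[of v S]) (use v vmax x S in auto)
qed

section \<open>Real and complex scalars\<close>

text \<open>Lets the real and the complex case share one proof: the identity ties conjugation to the
  norm and, as conjugation is additive and multiplicative, yields the polarization and adjointness
  rules below.\<close>

class scalar_field = euclidean_space + real_normed_field + conjugatable_field +
  assumes conjugate_mult_self_scaleR: "conjugate z * z = (norm z)\<^sup>2 *\<^sub>R 1"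

instance real :: scalar_field
  by standard (simp add: power2_eq_square)

instance complex :: scalar_field
  by standard (metis complex_norm_square conjugate_complex_def mult.commute of_real_def of_real_power)

lemma conjugate_mult_self:
  fixes z :: "'a::scalar_field"
  shows "conjugate z * z = of_real ((norm z)\<^sup>2)"
  unfolding of_real_def by (rule conjugate_mult_self_scaleR)

lemma conjugate_polarization:
  fixes u v :: "'a::scalar_field"
  shows "conjugate u * v + conjugate v * u = of_real (2 * (u \<bullet> v))"
proof -
  have "(norm (u + v))\<^sup>2 = (norm u)\<^sup>2 + (norm v)\<^sup>2 + 2 * (u \<bullet> v)"
    by (simp only: power2_norm_eq_inner) (simp add: algebra_simps inner_commute)
  then have "of_real ((norm (u + v))\<^sup>2)
      = of_real ((norm u)\<^sup>2) + of_real ((norm v)\<^sup>2) + (of_real (2 * (u \<bullet> v)) :: 'a)"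
    by (simp only: of_real_add)
  then show ?thesis
    by (simp only: conjugate_mult_self[symmetric] conjugate_dist_add) (simp add: algebra_simps)
qed

text \<open>Polarization turns both sides into the same two products, grouped differently:
  multiplication by \<open>conjugate w\<close> is the adjoint of multiplication by
  \<open>w\<close>.\<close>

lemma inner_mult_conjugate:
  fixes b w y :: "'a::scalar_field"
  shows "(b * w) \<bullet> y = b \<bullet> (conjugate w * y)"
proof -
  have "of_real (2 * ((b * w) \<bullet> y)) = (of_real (2 * (b \<bullet> (conjugate w * y))) :: 'a)"
    by (simp only: conjugate_polarization[symmetric]) (simp add: conjugate_dist_mul algebra_simps)
  then show ?thesis by (simp only: of_real_eq_iff)
qed

lemma inner_vector_scalar_mult:
  fixes w x :: "'a::scalar_field ^ 'd"
  shows "(b *s w) \<bullet> x = b \<bullet> cinner w x"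
  by (simp add: inner_vec_def cinner_def inner_sum_right inner_mult_conjugate)

text \<open>By adjointness the real functional \<open>b *s w\<close> reads off the
  \<open>b\<close>-coordinate of \<open>cinner w x\<close>. Moduli of scalar products thus become
  sums of squares of real linear functionals, the form that polytopes and continuity arguments
  need.\<close>

lemma norm_cinner_squared:
  fixes w x :: "'a::scalar_field ^ 'd"
  shows "(norm (cinner w x))\<^sup>2 = (\<Sum>b\<in>Basis. ((b *s w) \<bullet> x)\<^sup>2)"
  unfolding inner_vector_scalar_mult power2_norm_eq_inner
  by (subst euclidean_inner) (simp add: power2_eq_square inner_commute)

lemma norm_cinner_normalized:
  fixes w v :: "'a::scalar_field ^ 'd"
  shows "(norm (cinner w (v /\<^sub>R norm v)))\<^sup>2 = (norm (cinner w v))\<^sup>2 / (norm v)\<^sup>2"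
  by (simp add: norm_cinner_squared power_mult_distrib sum_distrib_left[symmetric] power_inverse
      divide_inverse mult.commute)

text \<open>Expanding each coefficient in the real basis of \<open>'a\<close> shows that the
  products of these basis scalars with a basis of \<open>V\<close> over \<open>'a\<close> span
  \<open>V\<close> over the reals.\<close>

lemma dim_le_DIM_mult_vec_dim:
  fixes V :: "('a::scalar_field ^ 'd) set"
  assumes "vec.subspace V"
  shows "subspace V" "dim V \<le> DIM('a) * vec.dim V"
proof -
  have scaleR: "c *\<^sub>R x = of_real c *s x" for c and x :: "'a ^ 'd"
    by (simp add: vec_eq_iff scaleR_conv_of_real[symmetric])
  show "subspace V"
    using assms by (auto simp: subspace_def vec.subspace_def scaleR)
  obtain B where B: "B \<subseteq> V" "vec.independent B" "V \<subseteq> vec.span B" "card B = vec.dim V"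
    using vec.basis_exists by blast
  have fin: "finite B" using B(2) by (rule vec.finiteI_independent)
  let ?C = "(\<lambda>(b, v). b *s v) ` ((Basis :: 'a set) \<times> B)"
  have "V \<subseteq> span ?C"
  proof
    fix x assume "x \<in> V"
    then have "x \<in> vec.span B" using B(3) by blast
    then obtain u where u: "x = (\<Sum>v\<in>B. u v *s v)"
      using vec.span_finite[OF fin] by auto
    have "u v *s v \<in> span ?C" if "v \<in> B" for v
    proof -
      have "u v *s v = (\<Sum>b\<in>Basis. (u v \<bullet> b) *\<^sub>R b) *s v" by (simp add: euclidean_representation)
      also have "\<dots> = (\<Sum>b\<in>Basis. (u v \<bullet> b) *\<^sub>R (b *s v))"
        unfolding vec.scale_sum_left by (intro sum.cong refl) (simp add: vec_eq_iff)
      also have "\<dots> \<in> span ?C"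
        by (intro span_sum span_scale span_base) (use that in auto)
      finally show ?thesis .
    qed
    then show "x \<in> span ?C" unfolding u by (intro span_sum)
  qed
  then have "dim V \<le> card ?C"
    by (rule dim_le_card) (simp add: fin)
  also have "\<dots> \<le> card ((Basis :: 'a set) \<times> B)" by (rule card_image_le) (simp add: fin)
  also have "\<dots> = DIM('a) * vec.dim V" by (simp add: card_cartesian_product B)
  finally show "dim V \<le> DIM('a) * vec.dim V" .
qed

lemma conjugate_one: "conjugate 1 = (1 :: 'a::scalar_field)"
  using conjugate_mult_self[of "1 :: 'a"] by simp

lemma inner_of_real_one: "(of_real c :: 'a::scalar_field) \<bullet> 1 = c"
  by (simp add: of_real_def norm_eq_1[symmetric])

lemma conjugate_of_real: "conjugate (of_real c) = (of_real c :: 'a::scalar_field)"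
  using conjugate_polarization[of "of_real c :: 'a" 1] by (simp add: conjugate_one inner_of_real_one)

lemma cinner_scaleR_left:
  fixes w x :: "'a::scalar_field ^ 'd"
  shows "cinner (c *\<^sub>R w) x = c *\<^sub>R cinner w x"
  by (simp add: cinner_def scaleR_conv_of_real[where 'a = 'a] conjugate_dist_mul conjugate_of_real sum_distrib_left
      mult.assoc)

section \<open>Independent samples and tight vertices\<close>

text \<open>The left summand indexes the real coordinates of the scalar products with the samples, the
  right one the fixed functionals that keep the polytope bounded.\<close>

fun constraint :: "'a::semiring_0 ^ 'd ^ 'k \<Rightarrow> ('k \<times> 'a) + 'a ^ 'd \<Rightarrow> 'a ^ 'd" where
  "constraint W (Inl (j, b)) = b *s (W $ j)"
| "constraint W (Inr e) = e"

lemma continuous_on_constraint [continuous_intros]: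
  fixes f :: "'p::topological_space \<Rightarrow> 'a::scalar_field ^ 'd ^ 'k"
  assumes "continuous_on A f"
  shows "continuous_on A (\<lambda>p. constraint (f p) i)"
\<comment> \<open>The case split concerns only the index \<open>i\<close>;
  \<open>f undefined\<close> is a placeholder for the matrix argument.\<close>
proof (cases "(f undefined, i)" rule: constraint.cases)
  case (1 W j b)
  then show ?thesis
    by (auto simp: vector_scalar_mult_def intro!: continuous_intros assms)
qed auto

section \<open>Measurability of the vertex events\<close>

lemma closed_Collect_ball:
  assumes "\<And>i. i \<in> J \<Longrightarrow> closed {x. P i x}"
  shows "closed {x. \<forall>i\<in>J. P i x}"
  using assms by (simp add: Collect_ball_eq closed_INT)

text \<open>A nontrivial kernel vector can be scaled to the unit sphere of \<open>V\<close>, which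
  is compact. Hence the matrices with nontrivial kernel form a projection of a closed set along a
  compact set, which is closed.\<close>

lemma open_trivial_kernel:
  fixes V :: "('a::scalar_field ^ 'd) set"
  assumes V: "subspace V"
  shows "open {y :: 'a ^ 'd ^ 'k. \<forall>u\<in>V. (\<forall>i\<in>J. constraint y i \<bullet> u = 0) \<longrightarrow> u = 0}"
proof -
  define C where "C = {y :: 'a ^ 'd ^ 'k. \<exists>u. u \<in> V \<inter> sphere 0 1 \<and> (\<forall>i\<in>J. constraint y i \<bullet> u = 0)}"
  have "compact (V \<inter> sphere 0 1)"
    by (simp add: V closed_subspace closed_Int_compact)
  moreover have "closed {p. \<forall>i\<in>J. constraint (snd p :: 'a ^ 'd ^ 'k) i \<bullet> fst p = 0}"
    by (intro closed_Collect_ball closed_Collect_eq continuous_intros)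
  ultimately have "closed C"
    unfolding C_def by (rule closed_compact_projection[THEN back_subst[where P = closed]]) simp
  moreover have "y \<in> - C \<longleftrightarrow> (\<forall>u\<in>V. (\<forall>i\<in>J. constraint y i \<bullet> u = 0) \<longrightarrow> u = 0)" for y
  proof
    assume y: "y \<in> - C"
    show "\<forall>u\<in>V. (\<forall>i\<in>J. constraint y i \<bullet> u = 0) \<longrightarrow> u = 0"
    proof (intro ballI impI, rule ccontr)
      fix u assume u: "u \<in> V" "\<forall>i\<in>J. constraint y i \<bullet> u = 0" "u \<noteq> 0"
      then have "y \<in> C"
        unfolding C_def
        by (intro CollectI exI[of _ "u /\<^sub>R norm u"]) (simp add: subspace_scale V)
      with y show False by simp
    qed
  next
    assume G: "\<forall>u\<in>V. (\<forall>i\<in>J. constraint y i \<bullet> u = 0) \<longrightarrow> u = 0"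
    show "y \<in> - C"
    proof
      assume "y \<in> C"
      then obtain u where "u \<in> V" "norm u = 1" "\<forall>i\<in>J. constraint y i \<bullet> u = 0"
        unfolding C_def by auto
      with G have "u = 0" by blast
      with \<open>norm u = 1\<close> show False by simp
    qed
  qed
  then have "- C = {y. \<forall>u\<in>V. (\<forall>i\<in>J. constraint y i \<bullet> u = 0) \<longrightarrow> u = 0}" by blast
  ultimately show ?thesis by (metis open_Compl)
qed

text \<open>The sample matrix enters twice, once for the tight constraints (\<open>y\<close>) and
  once for the samples in \<open>T\<close> (\<open>z\<close>), so that the two roles can later be
  given to independent variables. The kernel condition makes the vertex \<open>v\<close>
  unique.\<close>

definition tight_vertex_event ::
  "('a::scalar_field ^ 'd) set \<Rightarrow> ('a ^ 'd) set \<Rightarrow> real \<Rightarrow> (('k \<times> 'a) + 'a ^ 'd) set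
     \<Rightarrow> (('k \<times> 'a) + 'a ^ 'd \<Rightarrow> real) \<Rightarrow> 'k set \<Rightarrow> (('a ^ 'd ^ 'k) \<times> ('a ^ 'd ^ 'k)) set"
where
  "tight_vertex_event V K \<tau> J g T =
    {(y, z). (\<forall>u\<in>V. (\<forall>i\<in>J. constraint y i \<bullet> u = 0) \<longrightarrow> u = 0) \<and>
       (\<exists>v. v \<in> K \<and> (\<forall>i\<in>J. constraint y i \<bullet> v = g i) \<and>
          (\<forall>j\<in>T. (norm (cinner (z $ j) v))\<^sup>2 \<le> \<tau> * (norm v)\<^sup>2))}"

text \<open>Projections of closed sets along compact sets are closed, so the data whose tight
  constraints determine at most one point form an open set, those with some tight point a closed one.\<close>

lemma tight_vertex_event_borel:
  fixes V :: "('a::scalar_field ^ 'd) set"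
  assumes V: "subspace V" and K: "compact K"
  shows "tight_vertex_event V K \<tau> J g T \<in> sets (borel :: (('a ^ 'd ^ 'k) \<times> ('a ^ 'd ^ 'k)) measure)"
proof -
  define G where "G = {y :: 'a ^ 'd ^ 'k. \<forall>u\<in>V. (\<forall>i\<in>J. constraint y i \<bullet> u = 0) \<longrightarrow> u = 0}"
  define R where "R = {q :: ('a ^ 'd) \<times> ('a ^ 'd ^ 'k) \<times> ('a ^ 'd ^ 'k).
     (\<forall>i\<in>J. constraint (fst (snd q)) i \<bullet> fst q = g i) \<and>
     (\<forall>j\<in>T. (norm (cinner (snd (snd q) $ j) (fst q)))\<^sup>2 \<le> \<tau> * (norm (fst q))\<^sup>2)}"
  have "open (G \<times> (UNIV :: ('a ^ 'd ^ 'k) set))"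
    unfolding G_def by (intro open_Times open_trivial_kernel V open_UNIV)
  moreover have "closed R"
    unfolding R_def norm_cinner_squared vector_scalar_mult_def
    by (intro closed_Collect_conj closed_Collect_ball closed_Collect_eq closed_Collect_le
        continuous_intros)
  then have "closed {p. \<exists>v. v \<in> K \<and> (v, p) \<in> R}"
    by (rule closed_compact_projection[OF K])
  moreover have "tight_vertex_event V K \<tau> J g T = (G \<times> UNIV) \<inter> {p. \<exists>v. v \<in> K \<and> (v, p) \<in> R}"
    by (simp add: tight_vertex_event_def G_def R_def set_eq_iff)
  ultimately show ?thesis by simp
qed

text \<open>Fubini: by independence the joint law is a product, so the probability is an average of
  the slice probabilities over the law of \<open>Y\<close>.\<close>

lemma (in prob_space) indep_var_slice_bound:
  assumes ind: "indep_var S Y T Z" and A: "A \<in> sets (S \<Otimes>\<^sub>M T)"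
    and c: "\<And>y. y \<in> space S \<Longrightarrow> prob {t \<in> space M. (y, Z t) \<in> A} \<le> c"
  shows "prob {t \<in> space M. (Y t, Z t) \<in> A} \<le> c"
proof -
  have Y [measurable]: "random_variable S Y" and Z [measurable]: "random_variable T Z"
    and eq: "distr M S Y \<Otimes>\<^sub>M distr M T Z = distr M (S \<Otimes>\<^sub>M T) (\<lambda>x. (Y x, Z x))"
    using ind by (auto simp: indep_var_distribution_eq)
  interpret Q: prob_space "distr M T Z" by (rule prob_space_distr) simp
  interpret P: prob_space "distr M S Y" by (rule prob_space_distr) simp
  \<comment> \<open>Some slice exists, hence \<open>c\<close> is nonnegative; this is needed to
    return from \<open>ennreal c\<close> to the real bound.\<close>
  obtain y0 where "y0 \<in> space S" using P.not_empty by auto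
  from c[OF this] have c0: "0 \<le> c" by (rule order_trans[rotated]) simp
  have "ennreal (prob {t \<in> space M. (Y t, Z t) \<in> A})
      = emeasure (distr M (S \<Otimes>\<^sub>M T) (\<lambda>x. (Y x, Z x))) A"
    using A by (subst emeasure_distr)
      (auto simp: emeasure_eq_measure vimage_def Int_def conj_commute intro!: arg_cong[where f = prob])
  also have "\<dots> = (\<integral>\<^sup>+y. emeasure (distr M T Z) (Pair y -` A) \<partial>distr M S Y)"
    unfolding eq[symmetric] by (rule Q.emeasure_pair_measure_alt) (use A in simp)
  also have "\<dots> \<le> (\<integral>\<^sup>+y. ennreal c \<partial>distr M S Y)"
  proof (rule nn_integral_mono)
    fix y assume "y \<in> space (distr M S Y)"
    then have y: "y \<in> space S" by simp
    have "emeasure (distr M T Z) (Pair y -` A) = prob {t \<in> space M. (y, Z t) \<in> A}"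
      using sets_Pair1[OF A, of y] by (subst emeasure_distr)
        (auto simp: emeasure_eq_measure vimage_def Int_def conj_commute intro!: arg_cong[where f = prob])
    also have "\<dots> \<le> c" using c[OF y] by (simp add: ennreal_leI)
    finally show "emeasure (distr M T Z) (Pair y -` A) \<le> ennreal c" .
  qed
  also have "\<dots> = ennreal c" using P.emeasure_space_1 by simp
  finally show ?thesis using c0 by (simp add: ennreal_le_iff)
qed

text \<open>Disjoint blocks of an independent family are independent, and padding with zeros is
  measurable. The padding gives both blocks the type of the full sample, as the vertex event
  requires.\<close>

lemma (in prob_space) indep_var_disjoint_coordinates:
  fixes X :: "'k::finite \<Rightarrow> 'a \<Rightarrow> 'e::euclidean_space"
  assumes ind: "indep_vars (\<lambda>_. borel) X UNIV" and disj: "S \<inter> T = {}"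
  shows "indep_var borel (\<lambda>t. \<chi> j. if j \<in> S then X j t else 0)
     borel (\<lambda>t. \<chi> j. if j \<in> T then X j t else 0)"
proof -
  have meas: "(\<lambda>f. \<chi> j. if j \<in> A then f j else 0) \<in> PiM A (\<lambda>_. borel) \<rightarrow>\<^sub>M (borel :: ('e ^ 'k) measure)"
    for A :: "'k set"
  proof -
    have "(\<lambda>f. (\<chi> j. if j \<in> A then f j else 0) :: 'e ^ 'k) = (\<lambda>f. \<Sum>j\<in>A. axis j (f j))"
      by (auto simp: vec_eq_iff axis_def sum.If_cases fun_eq_iff if_distrib[where f = "\<lambda>x. x $ _"] cong: if_cong)
    moreover have "(\<lambda>f. axis j (f j) :: 'e ^ 'k) \<in> PiM A (\<lambda>_. borel) \<rightarrow>\<^sub>M borel" if "j \<in> A" for j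
    proof -
      have "continuous_on UNIV (axis j :: 'e \<Rightarrow> 'e ^ 'k)"
        unfolding axis_def
        by (intro continuous_on_vec_lambda, rename_tac i, case_tac "i = j") (auto intro: continuous_intros)
      then have "(axis j :: 'e \<Rightarrow> 'e ^ 'k) \<in> borel_measurable borel" by (rule borel_measurable_continuous_onI)
      then show ?thesis
        using that by (auto intro: measurable_compose[OF measurable_component_singleton])
    qed
    ultimately show ?thesis by simp
  qed
  have "indep_var (PiM S (\<lambda>_. borel)) (\<lambda>t. restrict (\<lambda>j. X j t) S)
      (PiM T (\<lambda>_. borel)) (\<lambda>t. restrict (\<lambda>j. X j t) T)"
    by (rule indep_var_restrict[OF ind disj]) auto
  from indep_var_compose[OF this meas meas] show ?thesis
    by (simp add: comp_def cong: if_cong)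
qed

section \<open>Probability of a single vertex pattern\<close>

locale small_ball_sample = prob_space N for N :: "'t measure" +
  fixes X :: "'k::finite \<Rightarrow> 't \<Rightarrow> 'a::scalar_field ^ 'd" and \<tau> p :: real
  assumes indep: "indep_vars (\<lambda>_. borel) X UNIV"
    and small_ball: "\<And>j u. norm u = 1 \<Longrightarrow> prob {t \<in> space N. (norm (cinner (X j t) u))\<^sup>2 \<le> \<tau>} \<le> p"
begin

lemma X_measurable [measurable]: "X j \<in> borel_measurable N"
  using indep by (auto simp: indep_vars_def)

lemma p_nonneg: "0 \<le> p"
proof -
  obtain u :: "'a ^ 'd" where "norm u = 1" using vector_choose_size[of 1] by auto
  from order_trans[OF measure_nonneg small_ball[OF this]] show ?thesis .
qed

lemma small_ball_scaled:
  assumes "v \<noteq> 0"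
  shows "prob {t \<in> space N. (norm (cinner (X j t) v))\<^sup>2 \<le> \<tau> * (norm v)\<^sup>2} \<le> p"
proof -
  have "(norm (cinner w (v /\<^sub>R norm v)))\<^sup>2 \<le> \<tau> \<longleftrightarrow> (norm (cinner w v))\<^sup>2 \<le> \<tau> * (norm v)\<^sup>2" for w
    using assms by (simp add: norm_cinner_normalized pos_divide_le_eq)
  then show ?thesis using small_ball[of "v /\<^sub>R norm v" j] assms by simp
qed

lemma borel_small_ball:
  "{w. (norm (cinner w v))\<^sup>2 \<le> c} \<in> sets (borel :: ('a ^ 'd) measure)"
  unfolding norm_cinner_squared vector_scalar_mult_def
  by (intro borel_closed closed_Collect_le continuous_intros)

lemma prob_all_small:
  assumes "v \<noteq> 0"
  shows "prob {t \<in> space N. \<forall>j\<in>T. (norm (cinner (X j t) v))\<^sup>2 \<le> \<tau> * (norm v)\<^sup>2} \<le> p ^ card T"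
\<comment> \<open>The product formula is for nonempty \<open>T\<close>: an empty intersection would
  not be confined to \<open>space N\<close>.\<close>
proof (cases "T = {}")
  case False
  let ?A = "{w. (norm (cinner w v))\<^sup>2 \<le> \<tau> * (norm v)\<^sup>2}"
  have "{t \<in> space N. \<forall>j\<in>T. (norm (cinner (X j t) v))\<^sup>2 \<le> \<tau> * (norm v)\<^sup>2}
      = (\<Inter>j\<in>T. X j -` ?A \<inter> space N)" using False by auto
  also have "prob \<dots> = (\<Prod>j\<in>T. prob (X j -` ?A \<inter> space N))"
    by (rule indep_varsD[OF indep]) (use False borel_small_ball in auto)
  also have "\<dots> \<le> (\<Prod>j\<in>T. p)"
    using small_ball_scaled[OF assms]
    by (intro prod_mono) (auto simp: vimage_def Int_def conj_commute)
  finally show ?thesis by simp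
qed (auto simp: prob_space)

text \<open>Freeze the samples outside \<open>T\<close>. They fix all constraints in
  \<open>J\<close>, hence at most one candidate vertex, which is nonzero; the independent samples in
  \<open>T\<close> must then all have a small product with a fixed vector.\<close>

lemma prob_tight_vertex_event:
  assumes V: "subspace V" and K: "compact K" "K \<subseteq> V" "0 \<notin> K"
    and J: "\<And>j b. Inl (j, b) \<in> J \<Longrightarrow> j \<notin> T"
  shows "{t \<in> space N. ((\<chi> j. X j t), (\<chi> j. X j t)) \<in> tight_vertex_event V K \<tau> J g T} \<in> events"
    (is "?E \<in> _")
    and "prob {t \<in> space N. ((\<chi> j. X j t), (\<chi> j. X j t)) \<in> tight_vertex_event V K \<tau> J g T}
       \<le> p ^ card T"
proof -
  let ?A = "tight_vertex_event V K \<tau> J g T"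
  let ?Y = "\<lambda>t. \<chi> j. if j \<in> - T then X j t else 0" and ?Z = "\<lambda>t. \<chi> j. if j \<in> T then X j t else 0"
  have ind: "indep_var borel ?Y borel ?Z"
    by (rule indep_var_disjoint_coordinates[OF indep]) auto
  have A: "?A \<in> sets (borel \<Otimes>\<^sub>M borel)"
    unfolding borel_prod by (rule tight_vertex_event_borel[OF V K(1)])
  \<comment> \<open>Constraints in \<open>J\<close> read no sample from \<open>T\<close>, and fixed
    functionals read none at all, so zeroing the samples in \<open>T\<close> changes
    nothing.\<close>
  have "constraint (\<chi> j. X j t) i = constraint (?Y t) i" if "i \<in> J" for t i
    using that J by (cases "((\<chi> j. X j t), i)" rule: constraint.cases) auto
  then have E: "?E = {t \<in> space N. (?Y t, ?Z t) \<in> ?A}"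
    by (simp add: tight_vertex_event_def cong: ball_cong conj_cong)
  have "(\<lambda>t. (?Y t, ?Z t)) \<in> N \<rightarrow>\<^sub>M borel \<Otimes>\<^sub>M borel"
    using ind by (auto simp: indep_var_distribution_eq)
  from measurable_sets[OF this A] show "?E \<in> events"
    unfolding E by (simp add: vimage_def Int_def conj_commute)
  show "prob ?E \<le> p ^ card T"
    unfolding E
  proof (rule indep_var_slice_bound[OF ind A])
    fix y
    show "prob {t \<in> space N. (y, ?Z t) \<in> ?A} \<le> p ^ card T"
    proof (cases "(\<forall>u\<in>V. (\<forall>i\<in>J. constraint y i \<bullet> u = 0) \<longrightarrow> u = 0) \<and>
        (\<exists>v\<in>K. \<forall>i\<in>J. constraint y i \<bullet> v = g i)")
      case False
      then have "{t \<in> space N. (y, ?Z t) \<in> ?A} = {}" by (auto simp: tight_vertex_event_def)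
      then show ?thesis using p_nonneg by (simp only: measure_empty) simp
    next
      case True
      then obtain v where v: "v \<in> K" "\<forall>i\<in>J. constraint y i \<bullet> v = g i" by auto
      have uniq: "v' = v" if "v' \<in> K" "\<forall>i\<in>J. constraint y i \<bullet> v' = g i" for v'
      proof -
        have "v' - v \<in> V" using that(1) v(1) K(2) V by (auto intro: subspace_diff)
        moreover have "\<forall>i\<in>J. constraint y i \<bullet> (v' - v) = 0"
          using that(2) v(2) by (simp add: inner_diff_right)
        ultimately have "v' - v = 0" using True by blast
        then show ?thesis by simp
      qed
      have "prob {t \<in> space N. (y, ?Z t) \<in> ?A}
          \<le> prob {t \<in> space N. \<forall>j\<in>T. (norm (cinner (X j t) v))\<^sup>2 \<le> \<tau> * (norm v)\<^sup>2}"
      proof (rule finite_measure_mono)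
        show "{t \<in> space N. (y, ?Z t) \<in> ?A}
            \<subseteq> {t \<in> space N. \<forall>j\<in>T. (norm (cinner (X j t) v))\<^sup>2 \<le> \<tau> * (norm v)\<^sup>2}"
          using uniq by (auto simp: tight_vertex_event_def)
        have "{t \<in> space N. (norm (cinner (X j t) v))\<^sup>2 \<le> \<tau> * (norm v)\<^sup>2} \<in> events" for j
          using measurable_sets[OF X_measurable borel_small_ball]
          by (simp add: vimage_def Int_def conj_commute)
        then show "{t \<in> space N. \<forall>j\<in>T. (norm (cinner (X j t) v))\<^sup>2 \<le> \<tau> * (norm v)\<^sup>2} \<in> events"
          by (intro sets.sets_Collect_finite_All) auto
      qed
      also have "\<dots> \<le> p ^ card T" by (rule prob_all_small) (use v K(3) in auto)
      finally show ?thesis .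
    qed
  qed
qed

end

section \<open>From small sums to vertices\<close>

text \<open>The triangle inequality for the orthonormal expansion; this crude bound suffices to show
  that the polytopes are bounded.\<close>

lemma norm_le_card_orthonormal_basis:
  assumes E: "pairwise orthogonal E" "\<forall>e\<in>E. norm e = 1" "finite E" and v: "v \<in> span E"
    and le: "\<forall>e\<in>E. \<bar>e \<bullet> v\<bar> \<le> 1"
  shows "norm v \<le> card E"
proof -
  have "v = (\<Sum>e\<in>E. (v \<bullet> e) *\<^sub>R e)"
    using orthonormal_basis_expand[OF E(1) _ v E(3)] E(2) by simp
  then have "norm v \<le> (\<Sum>e\<in>E. norm ((v \<bullet> e) *\<^sub>R e))" by (metis norm_sum)
  also have "\<dots> \<le> (\<Sum>e\<in>E. 1)"
    by (rule sum_mono) (use E(2) le in \<open>simp add: inner_commute\<close>)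
  finally show ?thesis by simp
qed

definition constraint_indices :: "'e set \<Rightarrow> (('k::finite \<times> 'a::euclidean_space) + 'e) set" where
  "constraint_indices E = Inl ` (UNIV \<times> Basis) \<union> Inr ` E"

lemma finite_constraint_indices [simp]:
  "finite E \<Longrightarrow> finite (constraint_indices E :: (('k::finite \<times> 'a::euclidean_space) + 'e) set)"
  by (simp add: constraint_indices_def)

lemma card_constraint_indices:
  assumes "finite E"
  shows "card (constraint_indices E :: (('k::finite \<times> 'a::euclidean_space) + 'e) set)
    = DIM('a) * CARD('k) + card E"
proof -
  have "card (constraint_indices E :: (('k \<times> 'a) + 'e) set)
      = card (Inl ` (UNIV \<times> Basis) :: (('k \<times> 'a) + 'e) set)
        + card (Inr ` E :: (('k \<times> 'a) + 'e) set)"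
    unfolding constraint_indices_def by (rule card_Un_disjoint) (use assms in auto)
  then show ?thesis
    by (simp add: card_image inj_on_def card_cartesian_product mult.commute)
qed

text \<open>The half-widths of the symmetric slabs that cut out the polytope.\<close>

definition offset :: "real \<Rightarrow> ('k \<times> 'a) + 'e \<Rightarrow> real" where
  "offset s = case_sum (\<lambda>_. s) (\<lambda>_. 1)"

lemma offset_simps [simp]: "offset s (Inl q) = s" "offset s (Inr e) = 1"
  by (simp_all add: offset_def)

text \<open>The range of possible vertices. The bound \<open>1 \<le> norm v\<close> comes from
  comparison with the unit vector in the polytope; it excludes 0 while keeping the set
  compact.\<close>

definition outer_box :: "'e::euclidean_space set \<Rightarrow> 'e set \<Rightarrow> 'e set" where
  "outer_box V E = {v \<in> V. 1 \<le> norm v \<and> (\<forall>e\<in>E. \<bar>e \<bullet> v\<bar> \<le> 1)}"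

lemma compact_outer_box:
  assumes E: "pairwise orthogonal E" "\<forall>e\<in>E. norm e = 1" "finite E" "span E = V"
  shows "compact (outer_box V E)"
proof -
  have "closed V" using E(4) closed_span by metis
  then have "closed (V \<inter> {v. 1 \<le> norm v \<and> (\<forall>e\<in>E. \<bar>e \<bullet> v\<bar> \<le> 1)})"
    by (intro closed_Int closed_Collect_conj closed_Collect_ball closed_Collect_le continuous_intros)
  moreover have "V \<inter> {v. 1 \<le> norm v \<and> (\<forall>e\<in>E. \<bar>e \<bullet> v\<bar> \<le> 1)} = outer_box V E"
    by (auto simp: outer_box_def)
  moreover have "bounded (outer_box V E)"
    unfolding bounded_iff outer_box_def
    using norm_le_card_orthonormal_basis[OF E(1,2,3)] E(4) by blast
  ultimately show ?thesis by (simp add: compact_eq_bounded_closed)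
qed

text \<open>The bound \<open>\<tau> / DIM('a)\<close> makes the polytope inscribed: if every real coordinate of
  a scalar product has square at most \<open>\<tau> / DIM('a)\<close>, its modulus has square at most \<open>\<tau>\<close>.\<close>

lemma tight_vertex_of_small_sum:
  fixes W :: "'a::scalar_field ^ 'd ^ 'k::finite"
  assumes V: "subspace V" and \<tau>: "\<tau> > 0"
    and E: "pairwise orthogonal E" "\<forall>e\<in>E. norm e = 1" "finite E" "span E = V" "card E = dim V"
    and x: "x \<in> V"
    and small: "(\<Sum>j\<in>UNIV. (norm (cinner (W $ j) x))\<^sup>2) < \<tau> / 10 * CARD('k) * (norm x)\<^sup>2"
  defines "I \<equiv> constraint_indices E"
  obtains \<sigma> T where "\<sigma> \<in> I \<rightarrow>\<^sub>E {-1, 0, 1}" "\<forall>j b. Inl (j, b) \<in> I \<longrightarrow> \<sigma> (Inl (j, b)) \<noteq> 0 \<longrightarrow> j \<notin> T"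
    "(10 - DIM('a)) * CARD('k) \<le> 10 * card T + 10 * dim V"
    "(W, W) \<in> tight_vertex_event V (outer_box V E) \<tau> {i \<in> I. \<sigma> i \<noteq> 0}
        (\<lambda>i. \<sigma> i * offset (sqrt (\<tau> / DIM('a))) i) T"
proof -
  define s where "s = sqrt (\<tau> / DIM('a))"
  have s: "s > 0" "s\<^sup>2 = \<tau> / DIM('a)" using \<tau> by (simp_all add: s_def)
  \<comment> \<open>At 0 the strict inequality would read \<open>0 < 0\<close>.\<close>
  have "x \<noteq> 0" using small by (auto simp: norm_cinner_squared)
  define u where "u = x /\<^sub>R norm x"
  have u: "u \<in> V" "norm u = 1" using x V \<open>x \<noteq> 0\<close> by (auto simp: u_def subspace_scale)
  have "(\<Sum>j\<in>UNIV. (norm (cinner (W $ j) u))\<^sup>2)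
      = (\<Sum>j\<in>UNIV. (norm (cinner (W $ j) x))\<^sup>2) / (norm x)\<^sup>2"
    by (simp add: u_def norm_cinner_normalized sum_divide_distrib)
  also have "\<dots> < \<tau> / 10 * CARD('k)"
    using small \<open>x \<noteq> 0\<close> by (simp add: pos_divide_less_eq)
  finally have small_u: "(\<Sum>j\<in>UNIV. (norm (cinner (W $ j) u))\<^sup>2) < \<tau> / 10 * CARD('k)" .
  define B where "B = {j. (norm (cinner (W $ j) u))\<^sup>2 \<le> \<tau> / DIM('a)}"
  \<comment> \<open>Markov counting: each sample outside \<open>B\<close> contributes at least
    \<open>\<tau> / DIM('a)\<close> to the sum.\<close>
  have "real (card (- B)) * (\<tau> / DIM('a)) \<le> (\<Sum>j\<in>- B. (norm (cinner (W $ j) u))\<^sup>2)"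
    by (rule sum_bounded_below) (auto simp: B_def)
  also have "\<dots> \<le> (\<Sum>j\<in>UNIV. (norm (cinner (W $ j) u))\<^sup>2)" by (rule sum_mono2) auto
  also note small_u
  finally have "\<tau> * (10 * card (- B)) < \<tau> * (CARD('k) * DIM('a))"
    by (simp add: field_simps)
  then have "10 * real (card (- B)) < real (CARD('k)) * real (DIM('a))" using \<tau> by simp
  then have "10 * card (- B) < CARD('k) * DIM('a)"
    by (metis of_nat_less_iff of_nat_mult of_nat_numeral)
  moreover have "card B + card (- B) = CARD('k)"
    using card_Un_disjoint[of B "- B"] by (simp add: Compl_partition)
  ultimately have cardB: "(10 - DIM('a)) * CARD('k) \<le> 10 * card B"
    unfolding diff_mult_distrib mult.commute[of "DIM('a)"] by linarith
  \<comment> \<open>The slabs of samples outside \<open>B\<close> are dropped, while the box is kept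
    entirely.\<close>
  define IB where "IB = {i \<in> I. \<forall>j b. i = Inl (j, b) \<longrightarrow> j \<in> B}"
  have "finite I" using E by (simp add: I_def)
  then have "finite IB" by (simp add: IB_def)
  have InrI: "Inr e \<in> IB" if "e \<in> E" for e
    using that by (auto simp: IB_def I_def constraint_indices_def)
  have InlI: "Inl (j, b) \<in> IB" if "j \<in> B" "b \<in> Basis" for j b
    using that by (auto simp: IB_def I_def constraint_indices_def)
  have off_pos: "offset s i > 0" for i :: "('k \<times> 'a) + 'a ^ 'd"
    using s by (cases i) auto
  have box: "\<forall>e\<in>E. \<bar>e \<bullet> v\<bar> \<le> 1" if "\<forall>i\<in>IB. \<bar>constraint W i \<bullet> v\<bar> \<le> offset s i" for v
    using that InrI by force
  have "bounded {y\<in>V. \<forall>i\<in>IB. \<bar>constraint W i \<bullet> y\<bar> \<le> offset s i}"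
    unfolding bounded_iff
    using norm_le_card_orthonormal_basis[OF E(1,2,3)] E(4) box by blast
  moreover have "\<forall>i\<in>IB. \<bar>constraint W i \<bullet> u\<bar> \<le> offset s i"
  proof
    fix i assume i: "i \<in> IB"
    show "\<bar>constraint W i \<bullet> u\<bar> \<le> offset s i"
    proof (cases i)
      case (Inr e)
      then have "norm e = 1" using i E(2) by (auto simp: IB_def I_def constraint_indices_def)
      then show ?thesis using Inr Cauchy_Schwarz_ineq2[of e u] u(2) by simp
    next
      case (Inl q)
      obtain j b where q: "q = (j, b)" by (cases q)
      have jb: "j \<in> B" "b \<in> Basis" using i Inl q by (auto simp: IB_def I_def constraint_indices_def)
      have "((b *s (W $ j)) \<bullet> u)\<^sup>2 \<le> (\<Sum>b\<in>Basis. ((b *s (W $ j)) \<bullet> u)\<^sup>2)"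
        by (rule member_le_sum) (use jb in auto)
      also have "\<dots> \<le> \<tau> / DIM('a)" using jb by (simp add: B_def norm_cinner_squared)
      finally have "\<bar>(b *s (W $ j)) \<bullet> u\<bar>\<^sup>2 \<le> \<tau> / DIM('a)" by simp
      then have "\<bar>(b *s (W $ j)) \<bullet> u\<bar> \<le> s" unfolding s_def by (rule real_le_rsqrt)
      then show ?thesis using Inl q by simp
    qed
  qed
  ultimately obtain v S where v: "v \<in> V" "\<forall>i\<in>IB. \<bar>constraint W i \<bullet> v\<bar> \<le> offset s i" "norm u \<le> norm v"
    and S: "S \<subseteq> IB" "card S \<le> dim V" "\<forall>i\<in>S. \<bar>constraint W i \<bullet> v\<bar> = offset s i"
      "\<forall>y\<in>V. (\<forall>i\<in>S. constraint W i \<bullet> y = 0) \<longrightarrow> y = 0"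
    by (rule polytope_vertex[OF V \<open>finite IB\<close> _ u(1)])
  \<comment> \<open>One function records both the tight set, as its support, and the signs.
    Restriction to \<open>I\<close> places it in a finite function space.\<close>
  define \<sigma> where "\<sigma> = (\<lambda>i\<in>I. if i \<in> S then sgn (constraint W i \<bullet> v) else 0)"
  \<comment> \<open>Samples supplying a tight constraint are discarded, since \<open>v\<close>
    depends on them; there are at most \<open>card S \<le> dim V\<close> of these.\<close>
  define T where "T = B - {j. \<exists>b. Inl (j, b) \<in> S}"
  have "S \<subseteq> I" using S(1) by (auto simp: IB_def)
  have nz: "constraint W i \<bullet> v \<noteq> 0" if "i \<in> S" for i
    using S(3) that off_pos[of i] by force
  have supp: "{i \<in> I. \<sigma> i \<noteq> 0} = S"
    using \<open>S \<subseteq> I\<close> nz by (auto simp: \<sigma>_def sgn_if)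
  have tight: "constraint W i \<bullet> v = \<sigma> i * offset s i" if "i \<in> S" for i
  proof -
    have "\<sigma> i * offset s i = sgn (constraint W i \<bullet> v) * \<bar>constraint W i \<bullet> v\<bar>"
      using that S(3) \<open>S \<subseteq> I\<close> by (auto simp: \<sigma>_def)
    then show ?thesis by (simp add: sgn_mult_abs)
  qed
  show ?thesis
  proof
    show "\<sigma> \<in> I \<rightarrow>\<^sub>E {-1, 0, 1}" by (auto simp: \<sigma>_def sgn_if)
    show "\<forall>j b. Inl (j, b) \<in> I \<longrightarrow> \<sigma> (Inl (j, b)) \<noteq> 0 \<longrightarrow> j \<notin> T"
      using supp by (auto simp: T_def)
    have "finite S" using S(1) \<open>finite IB\<close> finite_subset by blast
    have "{j. \<exists>b. Inl (j, b) \<in> S} \<subseteq> (\<lambda>i. fst (projl i)) ` S" by force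
    then have "card {j. \<exists>b. Inl (j, b) \<in> S} \<le> card S"
      using \<open>finite S\<close> by (meson card_image_le card_mono finite_imageI order_trans)
    moreover have "card B - card {j. \<exists>b. Inl (j, b) \<in> S} \<le> card T"
      unfolding T_def by (rule diff_card_le_card_Diff) simp
    ultimately have "card B \<le> card T + dim V" using S(2) by linarith
    then show "(10 - DIM('a)) * CARD('k) \<le> 10 * card T + 10 * dim V" using cardB by linarith
    have "v \<in> outer_box V E" using v u(2) box by (auto simp: outer_box_def)
    moreover have "(norm (cinner (W $ j) v))\<^sup>2 \<le> \<tau> * (norm v)\<^sup>2" if "j \<in> T" for j
    proof -
      have "j \<in> B" using that by (simp add: T_def)
      have "(norm (cinner (W $ j) v))\<^sup>2 \<le> (\<Sum>b\<in>(Basis :: 'a set). s\<^sup>2)"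
        unfolding norm_cinner_squared
      proof (rule sum_mono)
        fix b :: 'a assume "b \<in> Basis"
        then have "\<bar>(b *s (W $ j)) \<bullet> v\<bar> \<le> s"
          using v(2) InlI[OF \<open>j \<in> B\<close>] by force
        then show "((b *s (W $ j)) \<bullet> v)\<^sup>2 \<le> s\<^sup>2"
          using s(1) by (simp add: abs_le_square_iff[symmetric])
      qed
      also have "\<dots> = \<tau> * 1" using s(2) by simp
      also have "\<dots> \<le> \<tau> * (norm v)\<^sup>2"
        using \<tau> v(3) u(2) by (intro mult_left_mono) (simp_all add: one_le_power)
      finally show ?thesis .
    qed
    ultimately show "(W, W) \<in> tight_vertex_event V (outer_box V E) \<tau> {i \<in> I. \<sigma> i \<noteq> 0}
        (\<lambda>i. \<sigma> i * offset (sqrt (\<tau> / DIM('a))) i) T"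
      unfolding tight_vertex_event_def supp s_def[symmetric] using S(4) tight by blast
  qed
qed

section \<open>Union bound over all patterns\<close>

context small_ball_sample
begin

text \<open>\<open>U\<close> is the union of the vertex events over all admissible patterns, and
  every failure of the bound lies in one of them. The purely numerical hypothesis
  \<open>count\<close> lets the probability of one pattern beat the number of patterns; it is
  verified separately for real and complex scalars.\<close>

lemma lower_bound_except_rare_event:
  assumes V: "subspace V" "dim V \<le> D" and \<tau>: "\<tau> > 0" and p: "p \<le> 1 / 100"
    and count: "\<And>n. (10 - DIM('a)) * CARD('k) \<le> 10 * n + 10 * D \<Longrightarrow>
      20 * 3 ^ (DIM('a) * CARD('k) + D) * 2 ^ CARD('k) \<le> (100 :: nat) ^ n"
  obtains U where "U \<in> events" "prob U \<le> 1 / 20"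
    "\<forall>t\<in>space N - U. \<forall>x\<in>V.
      \<tau> / 10 * CARD('k) * (norm x)\<^sup>2 \<le> (\<Sum>j\<in>UNIV. (norm (cinner (X j t) x))\<^sup>2)"
proof -
  obtain E where E: "pairwise orthogonal E" "\<And>e. e \<in> E \<Longrightarrow> norm e = 1" "independent E"
    "card E = dim V" "span E = V" "E \<subseteq> V"
    using orthonormal_basis_subspace[OF V(1)] by metis
  have "finite E" using E(3) by (rule independent_imp_finite)
  have norm_E: "\<forall>e\<in>E. norm e = 1" using E(2) by blast
  define I where "I = (constraint_indices E :: (('k \<times> 'a) + 'a ^ 'd) set)"
  have "finite I" using \<open>finite E\<close> by (simp add: I_def)
  define P where "P = {(\<sigma>, T). \<sigma> \<in> I \<rightarrow>\<^sub>E {-1, 0, 1 :: real} \<and>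
     (\<forall>j b. Inl (j, b) \<in> I \<longrightarrow> \<sigma> (Inl (j, b)) \<noteq> 0 \<longrightarrow> j \<notin> T) \<and>
     (10 - DIM('a)) * CARD('k) \<le> 10 * card T + 10 * dim V}"
  define ev where "ev = (\<lambda>(\<sigma>, T). {t \<in> space N. ((\<chi> j. X j t), (\<chi> j. X j t)) \<in>
     tight_vertex_event V (outer_box V E) \<tau> {i \<in> I. \<sigma> i \<noteq> 0}
        (\<lambda>i. \<sigma> i * offset (sqrt (\<tau> / DIM('a))) i) T})"
  \<comment> \<open>Twenty times the bound on the number of patterns, so that events of probability
    at most \<open>1 / Q\<close> add up to at most \<open>1 / 20\<close>.\<close>
  define Q where "Q = (20 * 3 ^ (DIM('a) * CARD('k) + D) * 2 ^ CARD('k) :: real)"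
  have Q: "Q > 0" by (simp add: Q_def)
  have PQ: "P \<subseteq> (I \<rightarrow>\<^sub>E {-1, 0, 1}) \<times> UNIV" by (auto simp: P_def)
  have fin: "finite ((I \<rightarrow>\<^sub>E {-1, 0, 1 :: real}) \<times> (UNIV :: 'k set set))"
    using \<open>finite I\<close> by (intro finite_cartesian_product finite_PiE) auto
  have "finite P" using finite_subset[OF PQ fin] .
  have "card P \<le> card ((I \<rightarrow>\<^sub>E {-1, 0, 1 :: real}) \<times> (UNIV :: 'k set set))"
    by (rule card_mono[OF fin PQ])
  \<comment> \<open>Three sign values per constraint, and a subset \<open>T\<close> of the
    samples.\<close>
  also have "\<dots> = 3 ^ card I * 2 ^ CARD('k)"
    using \<open>finite I\<close> by (simp add: card_cartesian_product card_PiE card_Pow numeral_3_eq_3 flip: Pow_UNIV)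
  also have "\<dots> \<le> 3 ^ (DIM('a) * CARD('k) + D) * 2 ^ CARD('k)"
    using V(2) E(4) \<open>finite E\<close>
    by (intro mult_right_mono power_increasing) (auto simp: I_def card_constraint_indices)
  finally have "real (card P) \<le> real (3 ^ (DIM('a) * CARD('k) + D) * 2 ^ CARD('k))"
    by (simp only: of_nat_le_iff)
  then have cardP: "real (card P) \<le> Q / 20" by (simp add: Q_def)
  have box: "compact (outer_box V E)" "outer_box V E \<subseteq> V" "0 \<notin> outer_box V E"
    using compact_outer_box[OF E(1) norm_E \<open>finite E\<close> E(5)] by (auto simp: outer_box_def)
  have ev: "ev q \<in> events \<and> prob (ev q) \<le> 1 / Q" if "q \<in> P" for q
  proof -
    obtain \<sigma> T where q: "q = (\<sigma>, T)" by (cases q)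
    have avoid: "j \<notin> T" if "Inl (j, b) \<in> {i \<in> I. \<sigma> i \<noteq> 0}" for j b
      using that \<open>q \<in> P\<close> by (auto simp: P_def q)
    note ev = prob_tight_vertex_event[OF V(1) box, where J = "{i \<in> I. \<sigma> i \<noteq> 0}" and T = T, OF avoid]
    have "(10 - DIM('a)) * CARD('k) \<le> 10 * card T + 10 * D"
      using \<open>q \<in> P\<close> V(2) by (auto simp: P_def q)
    from count[OF this] have "real (20 * 3 ^ (DIM('a) * CARD('k) + D) * 2 ^ CARD('k)) \<le> real (100 ^ card T)"
      by (simp only: of_nat_le_iff)
    then have "Q \<le> 100 ^ card T" by (simp add: Q_def)
    have "prob (ev q) \<le> p ^ card T" using ev(2) by (simp add: ev_def q)
    also have "\<dots> \<le> (1 / 100) ^ card T" by (rule power_mono[OF p p_nonneg])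
    also have "\<dots> \<le> 1 / Q" using Q \<open>Q \<le> 100 ^ card T\<close> by (simp add: power_one_over frac_le)
    finally show ?thesis using ev(1) by (simp add: ev_def q)
  qed
  show ?thesis
  proof
    show "(\<Union>q\<in>P. ev q) \<in> events" using ev \<open>finite P\<close> by (intro sets.finite_UN) auto
    have "prob (\<Union>q\<in>P. ev q) \<le> (\<Sum>q\<in>P. prob (ev q))"
      using ev \<open>finite P\<close> by (intro measure_UNION_le) auto
    also have "\<dots> \<le> real (card P) * (1 / Q)"
      by (rule sum_bounded_above) (use ev in auto)
    also have "\<dots> \<le> (Q / 20) * (1 / Q)" using cardP Q by (intro mult_right_mono) auto
    also have "\<dots> = 1 / 20" using Q by simp
    finally show "prob (\<Union>q\<in>P. ev q) \<le> 1 / 20" .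
    show "\<forall>t\<in>space N - (\<Union>q\<in>P. ev q). \<forall>x\<in>V.
      \<tau> / 10 * CARD('k) * (norm x)\<^sup>2 \<le> (\<Sum>j\<in>UNIV. (norm (cinner (X j t) x))\<^sup>2)"
    proof (intro ballI, rule ccontr)
      fix t x assume t: "t \<in> space N - (\<Union>q\<in>P. ev q)" and x: "x \<in> V"
      assume "\<not> \<tau> / 10 * CARD('k) * (norm x)\<^sup>2 \<le> (\<Sum>j\<in>UNIV. (norm (cinner (X j t) x))\<^sup>2)"
      then have "(\<Sum>j\<in>UNIV. (norm (cinner ((\<chi> j. X j t) $ j) x))\<^sup>2) < \<tau> / 10 * CARD('k) * (norm x)\<^sup>2"
        by simp
      then obtain \<sigma> T where
        "\<sigma> \<in> I \<rightarrow>\<^sub>E {-1, 0, 1}" "\<forall>j b. Inl (j, b) \<in> I \<longrightarrow> \<sigma> (Inl (j, b)) \<noteq> 0 \<longrightarrow> j \<notin> T"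
        "(10 - DIM('a)) * CARD('k) \<le> 10 * card T + 10 * dim V"
        "((\<chi> j. X j t), (\<chi> j. X j t)) \<in> tight_vertex_event V (outer_box V E) \<tau> {i \<in> I. \<sigma> i \<noteq> 0}
          (\<lambda>i. \<sigma> i * offset (sqrt (\<tau> / DIM('a))) i) T"
        unfolding I_def
        by (rule tight_vertex_of_small_sum[OF V(1) \<tau> E(1) norm_E \<open>finite E\<close> E(5,4) x])
      then have "(\<sigma>, T) \<in> P" "t \<in> ev (\<sigma>, T)" using t by (auto simp: P_def ev_def)
      then show False using t by blast
    qed
  qed
qed

end

section \<open>Oblivious subspace injection\<close>

text \<open>The quadratic form at \<open>x\<close> is real-linear in the matrix, so it commutes with
  the expectation of \<open>outer_self (\<omega> s)\<close>.\<close>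

lemma isotropic_second_moment:
  fixes \<omega> :: "'s \<Rightarrow> 'a::scalar_field ^ 'd"
  assumes "isotropic M \<omega>"
  shows "has_bochner_integral M (\<lambda>s. (norm (cinner (\<omega> s) x))\<^sup>2) ((norm x)\<^sup>2)"
proof -
  \<comment> \<open>The inner product with 1 takes the real part, making \<open>L\<close>
    real-valued; at the matrices evaluated below the form is already real.\<close>
  define L where "L = (\<lambda>A :: 'a ^ 'd ^ 'd. (\<Sum>i\<in>UNIV. \<Sum>j\<in>UNIV. conjugate (x $ i) * A $ i $ j * x $ j) \<bullet> 1)"
  have "linear L"
    by (rule linearI) (simp_all add: L_def algebra_simps sum.distrib inner_add_left
        flip: scaleR_sum_right)
  then have "bounded_linear L" by (simp add: linear_conv_bounded_linear)
  then have "has_bochner_integral M (\<lambda>s. L (outer_self (\<omega> s))) (L (mat 1))"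
    by (rule has_bochner_integral_bounded_linear) (use assms in \<open>simp add: isotropic_def\<close>)
  moreover have "L (outer_self w) = (norm (cinner w x))\<^sup>2" for w
  proof -
    have "(\<Sum>i\<in>UNIV. \<Sum>j\<in>UNIV. conjugate (x $ i) * outer_self w $ i $ j * x $ j)
        = conjugate (cinner w x) * cinner w x"
      by (simp add: outer_self_def cinner_def sum_conjugate conjugate_dist_mul sum_product
          mult.assoc mult.left_commute mult.commute)
    then show ?thesis by (simp only: L_def conjugate_mult_self inner_of_real_one)
  qed
  moreover have "L (mat 1) = (norm x)\<^sup>2"
  proof -
    have "(\<Sum>i\<in>UNIV. \<Sum>j\<in>UNIV. conjugate (x $ i) * (mat 1 :: 'a ^ 'd ^ 'd) $ i $ j * x $ j)
        = (\<Sum>i\<in>UNIV. conjugate (x $ i) * x $ i)"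
      by (simp add: mat_def if_distrib[where f = "\<lambda>z. _ * z * _"] cong: if_cong)
    also have "\<dots> = of_real (\<Sum>i\<in>UNIV. (norm (x $ i))\<^sup>2)" by (simp add: conjugate_mult_self)
    also have "(\<Sum>i\<in>UNIV. (norm (x $ i))\<^sup>2) = (norm x)\<^sup>2"
      by (simp add: norm_vec_def L2_set_def sum_nonneg)
    finally show ?thesis by (simp only: L_def inner_of_real_one)
  qed
  ultimately show ?thesis by simp
qed

text \<open>Guarantees that the injection parameter \<open>\<tau> / 10\<close> is at most 1. The
  squared product has mean 1, so Markov bounds the probability of reaching \<open>\<tau>\<close> by
  \<open>1 / \<tau>\<close>, yet this probability is at least \<open>99 / 100\<close>.\<close>

lemma small_ball_level_le:
  fixes \<omega> :: "'s \<Rightarrow> 'a::scalar_field ^ 'd"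
  assumes "prob_space M" and iso: "isotropic M \<omega>" and u: "norm u = 1" and "\<tau> > 0"
    and small: "measure M {s \<in> space M. (norm (cinner (\<omega> s) u))\<^sup>2 \<le> \<tau>} \<le> 1 / 100"
  shows "\<tau> \<le> 10"
proof -
  interpret prob_space M by fact
  let ?Z = "\<lambda>s. (norm (cinner (\<omega> s) u))\<^sup>2"
  have hb: "has_bochner_integral M ?Z 1" using isotropic_second_moment[OF iso, of u] u by simp
  have [measurable]: "?Z \<in> borel_measurable M" using hb by (auto simp: has_bochner_integral_iff)
  have "measure M {s \<in> space M. \<tau> \<le> ?Z s} \<le> (\<integral>s. ?Z s \<partial>M) / \<tau>"
    using hb \<open>\<tau> > 0\<close> by (intro integral_Markov_inequality_measure[where A = "{}"]) (auto simp: has_bochner_integral_iff)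
  also have "(\<integral>s. ?Z s \<partial>M) = 1" using hb by (simp add: has_bochner_integral_iff)
  finally have markov: "measure M {s \<in> space M. \<tau> \<le> ?Z s} \<le> 1 / \<tau>" .
  have "1 = measure M ({s \<in> space M. ?Z s \<le> \<tau>} \<union> {s \<in> space M. \<tau> \<le> ?Z s})"
    by (subst prob_space[symmetric], rule arg_cong[where f = "measure M"]) auto
  also have "\<dots> \<le> measure M {s \<in> space M. ?Z s \<le> \<tau>} + measure M {s \<in> space M. \<tau> \<le> ?Z s}"
    by (rule measure_Un_le) simp_all
  finally have "99 / 100 \<le> 1 / \<tau>" using small markov by linarith
  then show ?thesis using \<open>\<tau> > 0\<close> by (simp add: field_simps)
qed

lemma norm_adjoint_scaled_columns:
  fixes Y :: "'k::finite \<Rightarrow> 'a::scalar_field ^ 'd"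
  shows "(norm (adjoint_matrix (scaled_columns Y) *v x))\<^sup>2
    = (\<Sum>j\<in>UNIV. (norm (cinner (Y j) x))\<^sup>2) / CARD('k)"
proof -
  have "(adjoint_matrix (scaled_columns Y) *v x) $ j = (1 / sqrt (real CARD('k))) *\<^sub>R cinner (Y j) x" for j
    unfolding cinner_scaleR_left[symmetric]
    by (simp add: adjoint_matrix_def scaled_columns_def cinner_def matrix_vector_mult_def)
  then have "(norm (adjoint_matrix (scaled_columns Y) *v x))\<^sup>2
      = (\<Sum>j\<in>UNIV. (norm ((1 / sqrt (real CARD('k))) *\<^sub>R cinner (Y j) x))\<^sup>2)"
    by (simp add: norm_vec_def L2_set_def sum_nonneg)
  also have "\<dots> = (\<Sum>j\<in>UNIV. (norm (cinner (Y j) x))\<^sup>2 / CARD('k))"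
    by (simp add: power_mult_distrib power_divide)
  finally show ?thesis by (simp add: sum_divide_distrib)
qed

text \<open>Second moments and small-ball bounds depend only on the law, so they pass to the copies.
  Averaging the former gives the expectation clause; the rare-event bound with
  \<open>D = DIM('a) * r\<close> gives the lower bound on subspaces.\<close>

lemma osi_of_small_ball:
  fixes \<omega> :: "'s \<Rightarrow> 'a::scalar_field ^ 'd" and X :: "'k::finite \<Rightarrow> 't \<Rightarrow> 'a ^ 'd"
  assumes M: "prob_space M" and N: "prob_space N" and iso: "isotropic M \<omega>" and \<tau>: "\<tau> > 0"
    and small: "\<And>u. norm u = 1 \<Longrightarrow>
      measure M {s \<in> space M. (norm (cinner (\<omega> s) u))\<^sup>2 \<le> \<tau>} \<le> 1 / 100"
    and iid: "iid_copies M \<omega> N X" and r: "r \<le> CARD('k)"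
    and count: "\<And>n. (10 - DIM('a)) * CARD('k) \<le> 10 * n + 10 * (DIM('a) * r) \<Longrightarrow>
      20 * 3 ^ (DIM('a) * CARD('k) + DIM('a) * r) * 2 ^ CARD('k) \<le> (100 :: nat) ^ n"
  shows "osi N (\<lambda>t. scaled_columns (\<lambda>j. X j t)) r (\<tau> / 10)"
proof -
  interpret prob_space N by (rule N)
  have ind: "indep_vars (\<lambda>_. borel) X UNIV" and distr_X: "distr N borel (X j) = distr M borel \<omega>" for j
    using iid by (auto simp: iid_copies_def)
  have [measurable]: "X j \<in> borel_measurable N" for j using ind by (auto simp: indep_vars_def)
  have \<omega> [measurable]: "\<omega> \<in> borel_measurable M" using iso by (simp add: isotropic_def)
  have cont: "continuous_on UNIV (\<lambda>w. (norm (cinner w x))\<^sup>2)" for x :: "'a ^ 'd"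
    unfolding norm_cinner_squared vector_scalar_mult_def by (intro continuous_intros)
  then have meas [measurable]: "(\<lambda>w. (norm (cinner w x))\<^sup>2) \<in> borel_measurable borel" for x :: "'a ^ 'd"
    by (rule borel_measurable_continuous_onI)
  have moment: "has_bochner_integral N (\<lambda>t. (norm (cinner (X j t) x))\<^sup>2) ((norm x)\<^sup>2)" for j x
  proof -
    have "has_bochner_integral (distr N borel (X j)) (\<lambda>w. (norm (cinner w x))\<^sup>2) ((norm x)\<^sup>2)"
      unfolding distr_X
      by (rule has_bochner_integral_distr[OF meas \<omega> isotropic_second_moment[OF iso]])
    then show ?thesis by (simp add: has_bochner_integral_iff integrable_distr_eq integral_distr)
  qed
  have small_X: "prob {t \<in> space N. (norm (cinner (X j t) u))\<^sup>2 \<le> \<tau>} \<le> 1 / 100" if "norm u = 1" for j u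
  proof -
    let ?A = "{w. (norm (cinner w u))\<^sup>2 \<le> \<tau>}"
    have A: "?A \<in> sets borel" by measurable
    have "prob {t \<in> space N. X j t \<in> ?A} = measure (distr N borel (X j)) ?A"
      using A by (subst measure_distr) (auto simp: vimage_def Int_def conj_commute)
    also have "\<dots> = measure M {s \<in> space M. \<omega> s \<in> ?A}"
      unfolding distr_X using A by (subst measure_distr) (auto simp: vimage_def Int_def conj_commute)
    also have "\<dots> \<le> 1 / 100" using small[OF that] by simp
    finally show ?thesis by simp
  qed
  interpret S: small_ball_sample N X \<tau> "1 / 100"
    by unfold_locales (use ind small_X in auto)
  have data [measurable]: "(\<lambda>t. (\<chi> j. X j t)) \<in> borel_measurable N"
    \<comment> \<open>With the blocks \<open>UNIV\<close> and \<open>{}\<close>, the first component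
      is the whole sample.\<close>
    using indep_var_rv1[OF indep_var_disjoint_coordinates[OF ind, of UNIV "{}"]] by simp
  have "(\<lambda>W :: 'a ^ 'd ^ 'k. (1 / sqrt (real CARD('k))) *\<^sub>R (\<chi> i j. W $ j $ i)) \<in> borel_measurable borel"
    by (intro borel_measurable_continuous_onI continuous_intros)
  from measurable_compose[OF data this]
  have \<Omega>: "(\<lambda>t. scaled_columns (\<lambda>j. X j t)) \<in> borel_measurable N"
    by (simp add: scaled_columns_def)
  obtain u :: "'a ^ 'd" where "norm u = 1" using vector_choose_size[of 1] by auto
  then have "\<tau> / 10 \<le> 1" using small_ball_level_le[OF M iso _ \<tau> small] by simp
  moreover have "has_bochner_integral N
      (\<lambda>t. (norm (adjoint_matrix (scaled_columns (\<lambda>j. X j t)) *v x))\<^sup>2) ((norm x)\<^sup>2)" for x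
  proof -
    have "has_bochner_integral N (\<lambda>t. (\<Sum>j\<in>UNIV. (norm (cinner (X j t) x))\<^sup>2) / CARD('k))
        ((\<Sum>j\<in>(UNIV :: 'k set). (norm x)\<^sup>2) / CARD('k))"
      by (intro has_bochner_integral_divide_zero has_bochner_integral_sum moment)
    then show ?thesis by (simp add: norm_adjoint_scaled_columns)
  qed
  moreover have "19 / 20 \<le> prob {t \<in> space N. \<forall>x\<in>V.
      \<tau> / 10 * (norm x)\<^sup>2 \<le> (norm (adjoint_matrix (scaled_columns (\<lambda>j. X j t)) *v x))\<^sup>2}" (is "_ \<le> prob ?G")
    if V: "vec.subspace V" "vec.dim V = r" for V :: "('a ^ 'd) set"
  proof -
    have G: "?G = {t \<in> space N. \<forall>x\<in>V. \<tau> / 10 * (norm x)\<^sup>2 \<le> (\<Sum>j\<in>UNIV. (norm (cinner (X j t) x))\<^sup>2) / CARD('k)}"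
      by (simp only: norm_adjoint_scaled_columns)
    let ?C = "{W :: 'a ^ 'd ^ 'k. \<forall>x\<in>V. \<tau> / 10 * (norm x)\<^sup>2 \<le> (\<Sum>j\<in>UNIV. (norm (cinner (W $ j) x))\<^sup>2) / CARD('k)}"
    have "closed ?C"
      unfolding norm_cinner_squared vector_scalar_mult_def
      by (intro closed_Collect_ball closed_Collect_le continuous_intros) simp_all
    then have "?C \<in> sets borel" by simp
    from measurable_sets[OF data this] have "?G \<in> events"
      unfolding G by (simp add: vimage_def Int_def conj_commute)
    have dim: "dim V \<le> DIM('a) * r" using dim_le_DIM_mult_vec_dim(2)[OF V(1)] V(2) by simp
    obtain U where U: "U \<in> events" "prob U \<le> 1 / 20"
      "\<forall>t\<in>space N - U. \<forall>x\<in>V.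
        \<tau> / 10 * CARD('k) * (norm x)\<^sup>2 \<le> (\<Sum>j\<in>UNIV. (norm (cinner (X j t) x))\<^sup>2)"
      by (rule S.lower_bound_except_rare_event[OF dim_le_DIM_mult_vec_dim(1)[OF V(1)] dim \<tau> order_refl count])
    have "19 / 20 \<le> prob (space N - U)" using U(1,2) by (simp add: prob_compl)
    also have "\<dots> \<le> prob ?G"
    proof (rule finite_measure_mono[OF _ \<open>?G \<in> events\<close>], rule subsetI)
      fix t assume "t \<in> space N - U"
      then show "t \<in> ?G" using U(3) unfolding G by (simp add: field_simps)
    qed
    finally show ?thesis .
  qed
  ultimately show ?thesis using r \<tau> \<Omega> by (simp add: osi_def)
qed

text \<open>Taking 30th powers makes every exponent comparable with a multiple of \<open>k\<close>:
  \<open>30 \<le> k\<close> absorbs the factor 20, \<open>30 * r \<le> 10 * k\<close> gives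
  \<open>30 * (k + r) \<le> 40 * k\<close> and \<open>17 * k \<le> 30 * n\<close>. It remains to
  compare two numbers.\<close>

lemma pattern_count_real:
  assumes "3 * r \<le> k" "131 \<le> k" "9 * k \<le> 10 * n + 10 * r"
  shows "20 * 3 ^ (k + r) * 2 ^ k \<le> (100 :: nat) ^ n"
proof (rule power_le_imp_le_base)
  have "(20 * 3 ^ (k + r) * 2 ^ k :: nat) ^ Suc 29 = 20 ^ 30 * 3 ^ (30 * (k + r)) * 2 ^ (30 * k)"
    by (simp only: power_mult_distrib power_mult[symmetric]) (simp add: mult.commute)
  also have "\<dots> \<le> 20 ^ k * 3 ^ (40 * k) * 2 ^ (30 * k)"
    by (rule mult_le_mono[OF mult_le_mono[OF power_increasing power_increasing] order_refl])
      (use assms in auto)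
  also have "\<dots> = (20 * 3 ^ 40 * 2 ^ 30) ^ k" by (simp only: power_mult power_mult_distrib)
  also have "\<dots> \<le> (100 ^ 17) ^ k" by (rule power_mono) simp_all
  also have "\<dots> = 100 ^ (17 * k)" by (simp only: power_mult)
  also have "\<dots> \<le> 100 ^ (n * Suc 29)" using assms by (intro power_increasing) auto
  finally show "(20 * 3 ^ (k + r) * 2 ^ k :: nat) ^ Suc 29 \<le> (100 ^ n) ^ Suc 29"
    by (simp only: power_mult)
qed simp

text \<open>The same with 45th powers: \<open>90 * r \<le> 5 * k\<close> gives
  \<open>45 * (2 * k + 2 * r) \<le> 95 * k\<close> and \<open>31 * k \<le> 45 * n\<close>.\<close>

lemma pattern_count_complex:
  assumes "18 * r \<le> k" "169 \<le> k" "8 * k \<le> 10 * n + 10 * (2 * r)"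
  shows "20 * 3 ^ (2 * k + 2 * r) * 2 ^ k \<le> (100 :: nat) ^ n"
proof (rule power_le_imp_le_base)
  have "(20 * 3 ^ (2 * k + 2 * r) * 2 ^ k :: nat) ^ Suc 44
      = 20 ^ 45 * 3 ^ (45 * (2 * k + 2 * r)) * 2 ^ (45 * k)"
    by (simp only: power_mult_distrib power_mult[symmetric]) (simp add: mult.commute)
  also have "\<dots> \<le> 20 ^ k * 3 ^ (95 * k) * 2 ^ (45 * k)"
    by (rule mult_le_mono[OF mult_le_mono[OF power_increasing power_increasing] order_refl])
      (use assms in auto)
  also have "\<dots> = (20 * 3 ^ 95 * 2 ^ 45) ^ k" by (simp only: power_mult power_mult_distrib)
  also have "\<dots> \<le> (100 ^ 31) ^ k" by (rule power_mono) simp_all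
  also have "\<dots> = 100 ^ (31 * k)" by (simp only: power_mult)
  also have "\<dots> \<le> 100 ^ (n * Suc 44)" using assms by (intro power_increasing) auto
  finally show "(20 * 3 ^ (2 * k + 2 * r) * 2 ^ k :: nat) ^ Suc 44 \<le> (100 ^ n) ^ Suc 44"
    by (simp only: power_mult)
qed simp

theorem theorem7p3:
  fixes \<tau> :: real and r :: nat
  assumes "\<tau> > 0"
  shows
    "(\<forall>(M :: 's measure) (\<omega> :: 's \<Rightarrow> real ^ 'd) (N :: 't measure) (X :: 'k::finite \<Rightarrow> 't \<Rightarrow> real ^ 'd).
        prob_space M \<longrightarrow> prob_space N \<longrightarrow> isotropic M \<omega> \<longrightarrow>
        (\<forall>u. norm u = 1 \<longrightarrow>
           measure M {s \<in> space M. (norm (cinner (\<omega> s) u))\<^sup>2 \<le> \<tau>} \<le> 1 / 100) \<longrightarrow>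
        iid_copies M \<omega> N X \<longrightarrow>
        CARD('k) \<ge> max (3 * r) 131 \<longrightarrow>
        osi N (\<lambda>t. scaled_columns (\<lambda>j. X j t)) r (\<tau> / 10))
   \<and> (\<forall>(M :: 's measure) (\<omega> :: 's \<Rightarrow> complex ^ 'd) (N :: 't measure) (X :: 'k::finite \<Rightarrow> 't \<Rightarrow> complex ^ 'd).
        prob_space M \<longrightarrow> prob_space N \<longrightarrow> isotropic M \<omega> \<longrightarrow>
        (\<forall>u. norm u = 1 \<longrightarrow>
           measure M {s \<in> space M. (norm (cinner (\<omega> s) u))\<^sup>2 \<le> \<tau>} \<le> 1 / 100) \<longrightarrow>
        iid_copies M \<omega> N X \<longrightarrow>
        CARD('k) \<ge> max (18 * r) 169 \<longrightarrow>
        osi N (\<lambda>t. scaled_columns (\<lambda>j. X j t)) r (\<tau> / 10))"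
proof (intro conjI allI impI)
  fix M :: "'s measure" and \<omega> :: "'s \<Rightarrow> real ^ 'd" and N :: "'t measure" and X :: "'k \<Rightarrow> 't \<Rightarrow> real ^ 'd"
  assume "prob_space M" "prob_space N" "isotropic M \<omega>"
    and "\<forall>u. norm u = 1 \<longrightarrow> measure M {s \<in> space M. (norm (cinner (\<omega> s) u))\<^sup>2 \<le> \<tau>} \<le> 1 / 100"
    and "iid_copies M \<omega> N X" and "max (3 * r) 131 \<le> CARD('k)"
  then show "osi N (\<lambda>t. scaled_columns (\<lambda>j. X j t)) r (\<tau> / 10)"
    \<comment> \<open>Here \<open>DIM(real) = 1\<close>, so the coefficient
      \<open>10 - DIM('a)\<close> is 9; in the complex case it is 8.\<close>
    using pattern_count_real[of r "CARD('k)"] assms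
    by (intro osi_of_small_ball[of M N \<omega>]) auto
next
  fix M :: "'s measure" and \<omega> :: "'s \<Rightarrow> complex ^ 'd" and N :: "'t measure" and X :: "'k \<Rightarrow> 't \<Rightarrow> complex ^ 'd"
  assume "prob_space M" "prob_space N" "isotropic M \<omega>"
    and "\<forall>u. norm u = 1 \<longrightarrow> measure M {s \<in> space M. (norm (cinner (\<omega> s) u))\<^sup>2 \<le> \<tau>} \<le> 1 / 100"
    and "iid_copies M \<omega> N X" and "max (18 * r) 169 \<le> CARD('k)"
  then show "osi N (\<lambda>t. scaled_columns (\<lambda>j. X j t)) r (\<tau> / 10)"
    using pattern_count_complex[of r "CARD('k)"] assms
    by (intro osi_of_small_ball[of M N \<omega>]) auto
qed

end
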